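(* Let $\mathbf a$ be a non-empty admissible composition and let $\varepsilon_1\ldots\varepsilon_k=\mathbf w(\mathbf a)$ be its binary word. For $1\le i\le k-1$, let $\mathbf a_i$ and $\mathbf b_i$ be the compositions whose binary words are $\varepsilon_{i+1}\ldots\varepsilon_k$ and $\overline{\varepsilon_i}\ldots\overline{\varepsilon_1}$ respectively. Then $$\zeta(\mathbf a)=\sum_{m=1}^{\infty}\psi_m(\mathbf a)\binom{2m}{m}^{-1},\qquad \psi_m(\mathbf a)=\sum_{i=1}^{k-1}\lambda(\varepsilon_i,\varepsilon_{i+1})\,\varphi_m(\mathbf a_i)\,\varphi_m(\mathbf b_i).$$
   Context: A composition is a finite sequence $(a_1,\ldots,a_r)$ of positive integers; it is admissible if $r\ge1$ and $a_1\ge2$, or $r=0$. For admissible non-empty $\mathbf a$, $\zeta(\mathbf a)=\sum_{n_1>\cdots>n_r>0}n_1^{-a_1}\cdots n_r^{-a_r}$. The binary word of a composition is $\mathbf w(a_1,\ldots,a_r)=\{0\}_{a_1-1}1\cdots\{0\}_{a_r-1}1$ ($\{0\}_u$ = $u$ letters $0$); $\mathbf w$ is a bijection from compositions onto binary words that are empty or end with $1$. $\overline0=1$, $\overline1=0$. For a non-empty composition $\mathbf c=(c_1,\ldots,c_r)$ and an integer $m\ge1$, $\varphi_m(\mathbf c)=m^{-c_1}\sum_{m>n_2>\cdots>n_r>0}n_2^{-c_2}\cdots n_r^{-c_r}$ (equal to $m^{-c_1}$ if $r=1$). For bits $\varepsilon,\varepsilon'$: $\lambda(1,0)=1$, $\lambda(0,0)=\lambda(1,1)=2$,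 $\lambda(0,1)=3$. *)

theory Defs
  imports "HOL-Analysis.Analysis"
begin

definition is_composition :: "nat list \<Rightarrow> bool" where
  "is_composition c \<longleftrightarrow> (\<forall>x\<in>set c. 1 \<le> x)"

definition admissible :: "nat list \<Rightarrow> bool" where
  "admissible c \<longleftrightarrow> is_composition c \<and> (c = [] \<or> 2 \<le> hd c)"

definition decreasing_tuples :: "nat \<Rightarrow> nat list set" where
  "decreasing_tuples r = {ns. length ns = r \<and> sorted_wrt (>) ns \<and> (\<forall>n\<in>set ns. 0 < n)}"

definition mzv_term :: "nat list \<Rightarrow> nat list \<Rightarrow> real" where
  "mzv_term c ns = (\<Prod>j<length c. 1 / real (ns ! j) ^ (c ! j))"

definition mzv :: "nat list \<Rightarrow> real" where
  "mzv c = (\<Sum>\<^sub>\<infinity>ns\<in>decreasing_tuples (length c). mzv_term c ns)"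

text \<open>Bits are Booleans: \<open>False\<close> is the letter 0, \<open>True\<close> is the letter 1, and complementing
  a bit is \<open>Not\<close>.\<close>

definition binary_word :: "nat list \<Rightarrow> bool list" where
  "binary_word c = concat (map (\<lambda>x. replicate (x - 1) False @ [True]) c)"

lemma binary_word_Nil [simp]: "binary_word [] = []"
  by (simp add: binary_word_def)

lemma binary_word_Cons [simp]:
  "binary_word (x # c) = replicate (x - 1) False @ True # binary_word c"
  by (simp add: binary_word_def)

lemma replicate_False_True_inj:
  assumes "replicate p False @ True # u = replicate q False @ True # v"
  shows "p = q \<and> u = v"
  using assms
proof (induction p arbitrary: q)
  case 0
  then show ?case by (cases q) auto
next
  case (Suc p)
  then show ?case by (cases q) auto
qed

lemma binary_word_inj:
  assumes "is_composition c" "is_composition d" "binary_word c = binary_word d"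
  shows "c = d"
  using assms
proof (induction c arbitrary: d)
  case Nil
  then show ?case by (cases d) auto
next
  case (Cons x c)
  then obtain y d' where d: "d = y # d'" by (cases d) auto
  have "x - 1 = y - 1 \<and> binary_word c = binary_word d'"
    using Cons.prems(3) d by (intro replicate_False_True_inj) simp
  moreover have "1 \<le> x" "1 \<le> y" "is_composition c" "is_composition d'"
    using Cons.prems d by (auto simp: is_composition_def)
  ultimately show ?case using Cons.IH[of d'] d by (metis eq_diff_iff)
qed

lemma binary_word_ends: "c = [] \<or> last (binary_word c)"
proof (induction c)
  case (Cons x c)
  then show ?case by (cases c) auto
qed simp

lemma binary_word_surj:
  assumes "v = [] \<or> last v"
  shows "\<exists>c. is_composition c \<and> binary_word c = v"
  using assms
proof (induction v)
  case Nil
  show ?case by (rule exI[of _ "[]"]) (simp add: is_composition_def)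
next
  case (Cons b v)
  then have "v = [] \<or> last v" by (cases v) auto
  with Cons.IH obtain c where c: "is_composition c" "binary_word c = v" by blast
  show ?case
  proof (cases b)
    case True
    then show ?thesis
      using c by (intro exI[of _ "1 # c"]) (auto simp: is_composition_def)
  next
    case False
    then have "v \<noteq> []" using Cons.prems by auto
    then obtain x d where d: "c = x # d" using c by (cases c) auto
    have "1 \<le> x" using c d by (auto simp: is_composition_def)
    then obtain y where "x = Suc y" by (cases x) auto
    then show ?thesis
      using c d False by (intro exI[of _ "Suc x # d"]) (auto simp: is_composition_def)
  qed
qed

lemma bij_betw_binary_word:
  "bij_betw binary_word {c. is_composition c} {v. v = [] \<or> last v}"
  unfolding bij_betw_def
proof
  show "inj_on binary_word {c. is_composition c}"
    by (rule inj_onI, rule binary_word_inj) simp_all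
  show "binary_word ` {c. is_composition c} = {v. v = [] \<or> last v}"
  proof (intro equalityI subsetI)
    fix v assume "v \<in> binary_word ` {c. is_composition c}"
    then obtain c where "v = binary_word c" by (elim imageE)
    with binary_word_ends[of c] show "v \<in> {v. v = [] \<or> last v}" by (elim disjE) simp_all
  next
    fix v :: "bool list" assume "v \<in> {v. v = [] \<or> last v}"
    then have "v = [] \<or> last v" by (rule CollectD)
    from binary_word_surj[OF this] obtain c where "is_composition c" "binary_word c = v"
      by (elim exE conjE)
    then show "v \<in> binary_word ` {c. is_composition c}" by (intro image_eqI[of _ _ c]) simp_all
  qed
qed

definition composition_of_word :: "bool list \<Rightarrow> nat list" where
  "composition_of_word v = (THE c. is_composition c \<and> binary_word c = v)"

lemma composition_of_word:
  assumes "v = [] \<or> last v"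
  shows "is_composition (composition_of_word v)"
    and "binary_word (composition_of_word v) = v"
proof -
  have "\<exists>!c. is_composition c \<and> binary_word c = v"
    using binary_word_surj[OF assms] binary_word_inj by blast
  from theI'[OF this] show "is_composition (composition_of_word v)"
    and "binary_word (composition_of_word v) = v"
    by (simp_all add: composition_of_word_def)
qed

definition phi :: "nat \<Rightarrow> nat list \<Rightarrow> real" where
  "phi m c = 1 / real m ^ hd c *
     (\<Sum>ns\<in>{ns \<in> decreasing_tuples (length c - 1). \<forall>n\<in>set ns. n < m}. mzv_term (tl c) ns)"

lemma finite_bounded_decreasing_tuples:
  "finite {ns \<in> decreasing_tuples r. \<forall>n\<in>set ns. n < m}"
  by (rule finite_subset[OF _ finite_lists_length_eq[of "{..<m}" r]])
     (auto simp: decreasing_tuples_def)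

fun lam :: "bool \<Rightarrow> bool \<Rightarrow> real" where
  "lam True False = 1"
| "lam False False = 2"
| "lam True True = 2"
| "lam False True = 3"

definition suffix_composition :: "nat list \<Rightarrow> nat \<Rightarrow> nat list" where
  "suffix_composition a i = composition_of_word (drop i (binary_word a))"

definition dual_prefix_composition :: "nat list \<Rightarrow> nat \<Rightarrow> nat list" where
  "dual_prefix_composition a i = composition_of_word (rev (map Not (take i (binary_word a))))"

text \<open>List positions start at 0, so the \<open>i\<close>-th letter of the word is at position \<open>i - 1\<close>.\<close>

definition psi :: "nat \<Rightarrow> nat list \<Rightarrow> real" where
  "psi m a = (\<Sum>i = 1..length (binary_word a) - 1.
     lam (binary_word a ! (i - 1)) (binary_word a ! i) *
     phi m (suffix_composition a i) * phi m (dual_prefix_composition a i))"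

end

theory Submission
  imports Defs
begin

text \<open>
  Let \<open>C(p, q) = p! q! / (p + q)!\<close>. Cut the binary word after its \<open>i\<close>-th letter and consider
  the connected sum \<open>T\<^sub>i\<close> of \<open>\<phi>\<^sub>p(b\<^sub>i) \<phi>\<^sub>q(a\<^sub>i) C(p, q)\<close>, restricted to the half plane \<open>p < q\<close>.
  Since \<open>q C(p, q) / p = C(p - 1, q) - C(p, q)\<close>, summation by parts carries one letter across the
  cut, as in the proof of duality by Seki and Yamamoto; without the restriction the sum would not
  change, and with it a diagonal contribution at \<open>p = q = m\<close>, weighted by
  \<open>C(m, m) = 1 / binom(2m, m)\<close>, is split off. As \<open>T\<^sub>0 = \<zeta>(a)\<close> and \<open>T\<^sub>k = 0\<close>, \<open>\<zeta>(a)\<close> is the sum of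
  these contributions. All terms are nonnegative, so one may compute in the extended nonnegative
  reals; convergence of \<open>\<zeta>(a)\<close> then follows from that of the diagonal sums.
\<close>

section \<open>Nested sums attached to binary words\<close>

text \<open>
  \<open>word_sum (binary_word c) m\<close> is \<open>\<phi>\<^sub>m(c)\<close>. The value for the empty word, the indicator of 0,
  makes the recursion uniform; division by zero gives the value 0 at 0 for all other words.
\<close>
fun word_sum :: "bool list \<Rightarrow> nat \<Rightarrow> real" where
  "word_sum [] n = (if n = 0 then 1 else 0)"
| "word_sum (False # v) n = word_sum v n / real n"
| "word_sum (True # v) n = (\<Sum>j<n. word_sum v j) / real n"

lemma word_sum_nonneg [simp]: "0 \<le> word_sum v n"
  by (induction v n rule: word_sum.induct) (auto intro!: divide_nonneg_nonneg sum_nonneg)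

text \<open>A crude bound, but enough against the geometric decay of
  \<open>connector m m\<close>.\<close>

lemma word_sum_le_1: "word_sum v n \<le> 1"
proof (induction v n rule: word_sum.induct)
  case (2 v n)
  show ?case
  proof (cases "n = 0")
    case False
    then have "word_sum v n \<le> real n" using 2 by linarith
    then show ?thesis using False by simp
  qed simp
next
  case (3 v n)
  have "(\<Sum>j<n. word_sum v j) \<le> (\<Sum>j<n. 1)" using 3 by (intro sum_mono) auto
  then show ?case by (cases "n = 0") auto
qed simp

lemma word_sum_0: "v \<noteq> [] \<Longrightarrow> word_sum v 0 = 0"
  by (cases v rule: list.exhaust) (metis (full_types) div_by_0 of_nat_0 word_sum.simps(2,3))+

section \<open>The connector and its telescoping identities\<close>

definition connector :: "nat \<Rightarrow> nat \<Rightarrow> real" where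
  "connector p q = fact p * fact q / fact (p + q)"

lemma connector_nonneg [simp]: "0 \<le> connector p q"
  by (simp add: connector_def)

lemma connector_commute: "connector p q = connector q p"
  by (simp add: connector_def add.commute mult.commute)

lemma connector_0 [simp]: "connector 0 q = 1"
  by (simp add: connector_def)

lemma connector_diag: "connector m m = 1 / real (2 * m choose m)"
  by (simp add: connector_def binomial_fact mult_2)

lemma connector_Suc_left: "connector p q * real (Suc p) = connector (Suc p) q * real (Suc (p + q))"
  by (simp add: connector_def field_simps del: of_nat_Suc)

lemma connector_diff:
  "connector (Suc p) q * real q / real (Suc p) = connector p q - connector (Suc p) q"
  using connector_Suc_left[of p q] by (simp add: field_simps)

lemma connector_Suc_diag: "connector m (Suc m) = 2 * connector (Suc m) (Suc m)"
  using connector_diff[of m "Suc m"] by simp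

lemma connector_Suc_le: "connector (Suc p) q \<le> connector p q"
  using connector_diff[of p q] by (smt (verit) connector_nonneg divide_nonneg_nonneg mult_nonneg_nonneg of_nat_0_le_iff)

text \<open>Passing from \<open>(m, m)\<close> to \<open>(m + 1, m + 1)\<close> raises one argument
  at a time: the first step does not increase the value, the second halves it exactly.\<close>

lemma connector_diag_le: "connector m m \<le> (1/2) ^ m"
proof (induction m)
  case (Suc m)
  have "connector m (Suc m) \<le> connector m m"
    using connector_Suc_le[of m m] by (simp add: connector_commute)
  then show ?case using Suc connector_Suc_diag[of m] by simp
qed simp

text \<open>For \<open>p = 1\<close> the value is exactly \<open>1 / (q + 1)\<close>, and the
  connector is decreasing in \<open>p\<close>.\<close>

lemma connector_tendsto_0:
  assumes "p > 0"
  shows "(\<lambda>q. connector p q) \<longlonglongrightarrow> 0"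
proof -
  have "connector p q \<le> 1 / real (Suc q)" for q
    using assms
  proof (induction p rule: nat_induct_non_zero)
    case 1
    show ?case by (simp add: connector_def field_simps)
  next
    case (Suc p)
    then show ?case using connector_Suc_le[of p q] by linarith
  qed
  then show ?thesis
    by (intro tendsto_sandwich[OF _ _ tendsto_const LIMSEQ_inverse_real_of_nat])
       (auto simp: inverse_eq_divide)
qed

text \<open>By symmetry and \<open>connector_diff\<close>, \<open>connector p q / q\<close> is the
  difference of \<open>connector p (q - 1) / p\<close> and \<open>connector p q / p\<close>, so the
  tail telescopes.\<close>

lemma connector_tail_sums:
  assumes "p > 0"
  shows "(\<lambda>q. if M < q then connector p q / real q else 0) sums (connector p M / real p)"
proof -
  let ?g = "\<lambda>n. - connector p (M + n) / real p"
  have eq: "connector p (Suc (M + n)) / real (Suc (M + n)) = ?g (Suc n) - ?g n" for n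
    using connector_diff[of "M + n" p] assms
    by (simp add: connector_commute[of p] field_simps)
  have "?g \<longlonglongrightarrow> - 0 / real p"
    using LIMSEQ_ignore_initial_segment[OF connector_tendsto_0[OF assms], of M] assms
    by (intro tendsto_intros) (auto simp: add.commute)
  then have "(\<lambda>n. connector p (Suc (M + n)) / real (Suc (M + n))) sums (connector p M / real p)"
    using telescope_sums[of ?g 0] unfolding eq by simp
  \<comment> \<open>The subtracted finite sum is 0, as all its indices are at most \<open>M\<close>;
    it only brings the claim into the form of the shift rule.\<close>
  then have "(\<lambda>n. if M < n + Suc M then connector p (n + Suc M) / real (n + Suc M) else 0)
     sums (connector p M / real p - (\<Sum>q<Suc M. if M < q then connector p q / real q else 0))"
    by (simp add: add.commute)
  then show ?thesis by (subst (asm) sums_iff_shift')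
qed

section \<open>Connected sums over the half plane, and moving a letter 0\<close>

text \<open>\<open>u\<close> is meant to be the reversed complement of a prefix and \<open>v\<close>
  the remaining suffix. For fixed \<open>q\<close> the sum over \<open>p\<close> is finite and stays
  real; only the outer series may diverge.\<close>

definition connected_sum :: "bool list \<Rightarrow> bool list \<Rightarrow> ennreal" where
  "connected_sum u v = (\<Sum>q. ennreal (word_sum v q * (\<Sum>p<q. word_sum u p * connector p q)))"

definition diagonal_term :: "bool list \<Rightarrow> bool list \<Rightarrow> nat \<Rightarrow> real" where
  "diagonal_term u v m = connector m m * word_sum u m * word_sum v m"

lemma diagonal_term_nonneg [simp]: "0 \<le> diagonal_term u v m"
  by (simp add: diagonal_term_def)

text \<open>Raising the cutoff from \<open>n\<close> to \<open>n + 1\<close> adds to the right side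
  the partial sum of \<open>word_sum u\<close> below \<open>n\<close> times a connector difference,
  which \<open>connector_diff\<close> turns into the new term on the left.\<close>

lemma sum_by_parts_connector:
  assumes "0 < q"
  shows "(\<Sum>p<n. word_sum (True # u) p * connector p q) =
    (\<Sum>p<n. word_sum u p * (connector p q - (connector (n - 1) q))) / real q"
proof (induction n)
  case (Suc n)
  show ?case
  proof (cases n)
    case 0 then show ?thesis by simp
  next
    case [simp]: (Suc k)
    have d: "connector n q * real q / real n = connector k q - connector n q"
      using connector_diff[of k q] by simp
    let ?S = "\<Sum>p<n. word_sum u p"
    \<comment> \<open>The term at \<open>p = n\<close> vanishes, because the subtracted boundary
      value is then \<open>connector n q\<close> itself.\<close>
    have "(\<Sum>p<Suc n. word_sum u p * (connector p q - connector (Suc n - 1) q))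
       = (\<Sum>p<n. word_sum u p * (connector p q - connector k q) + word_sum u p * (connector k q - connector n q))"
      by (simp add: algebra_simps)
    also have "\<dots> = (\<Sum>p<n. word_sum u p * (connector p q - connector k q)) + ?S * (connector k q - connector n q)"
      by (simp only: sum.distrib sum_distrib_right)
    also have "\<dots> / real q = (\<Sum>p<n. word_sum (True # u) p * connector p q) + ?S * (connector n q / real n)"
      unfolding d[symmetric] add_divide_distrib Suc.IH using assms by simp
    finally show ?thesis by (simp add: ac_simps)
  qed
qed simp

text \<open>Summation by parts with cutoff \<open>q\<close> leaves the boundary value
  \<open>connector (q - 1) q\<close>. It equals \<open>2 * connector q q\<close>, whence the
  coefficient 2.\<close>

lemma connected_sum_False:
  "connected_sum u (False # v) =
     connected_sum (True # u) v + (\<Sum>m. ennreal (2 * diagonal_term (True # u) v m))"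
proof -
  have "word_sum (False # v) q * (\<Sum>p<q. word_sum u p * connector p q) =
     word_sum v q * (\<Sum>p<q. word_sum (True # u) p * connector p q) + 2 * diagonal_term (True # u) v q" for q
  proof (cases q)
    case [simp]: (Suc k)
    let ?A = "\<Sum>p<q. word_sum u p * connector p q" and ?S = "\<Sum>p<q. word_sum u p"
    have "(\<Sum>p<q. word_sum u p * (connector p q - connector (q - 1) q))
        = ?A - ?S * connector k q"
      unfolding sum_distrib_right by (simp add: sum_subtractf algebra_simps)
    then have "(\<Sum>p<q. word_sum (True # u) p * connector p q) = (?A - ?S * (2 * connector q q)) / real q"
      using sum_by_parts_connector[of q u q] connector_Suc_diag[of k] by simp
    then have "(\<Sum>p<q. word_sum (True # u) p * connector p q) = ?A / real q - 2 * connector q q * word_sum (True # u) q"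
      by (simp add: diff_divide_distrib)
    then show ?thesis
      unfolding diagonal_term_def by (simp only: word_sum.simps(2)) (simp only: algebra_simps times_divide_eq_left times_divide_eq_right)
  qed (simp add: diagonal_term_def)
  then have "connected_sum u (False # v) = (\<Sum>q. ennreal (word_sum v q * (\<Sum>p<q. word_sum (True # u) p * connector p q))
       + ennreal (2 * diagonal_term (True # u) v q))"
    unfolding connected_sum_def by (simp only:) (subst ennreal_plus; auto intro!: mult_nonneg_nonneg sum_nonneg simp del: word_sum.simps)
  then show ?thesis
    unfolding connected_sum_def by (simp only: suminf_add[OF summableI summableI])
qed

section \<open>Exchanging the order of summation, and moving a letter 1\<close>

text \<open>One of the two series is read as an integral over the counting measure.\<close>

lemma suminf_swap_ennreal: "(\<Sum>i. \<Sum>j. f i j) = (\<Sum>j. \<Sum>i. f i j)" for f :: "nat \<Rightarrow> nat \<Rightarrow> ennreal"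
  using nn_integral_suminf[of "\<lambda>i j. f i j" "count_space UNIV"]
  by (simp add: nn_integral_count_space_nat)

text \<open>The inner sum of the connected sum when \<open>p\<close> is fixed first.\<close>

definition tail_sum :: "bool list \<Rightarrow> nat \<Rightarrow> ennreal" where
  "tail_sum v p = (\<Sum>q. ennreal (if p < q then word_sum v q * connector p q else 0))"

lemma connected_sum_eq_tail_sum:
  "connected_sum u v = (\<Sum>p. ennreal (word_sum u p) * tail_sum v p)"
proof -
  have "ennreal (word_sum v q * (\<Sum>p<q. word_sum u p * connector p q))
      = (\<Sum>p. ennreal (word_sum u p) * ennreal (if p < q then word_sum v q * connector p q else 0))" for q
  proof -
    have "(\<Sum>p. ennreal (word_sum u p) * ennreal (if p < q then word_sum v q * connector p q else 0))
       = (\<Sum>p<q. ennreal (word_sum u p) * ennreal (if p < q then word_sum v q * connector p q else 0))"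
      by (intro suminf_finite) auto
    also have "\<dots> = (\<Sum>p<q. ennreal (word_sum u p * (word_sum v q * connector p q)))"
      by (intro sum.cong) (auto simp: ennreal_mult)
    also have "\<dots> = ennreal (\<Sum>p<q. word_sum u p * (word_sum v q * connector p q))"
      by (intro sum_ennreal) auto
    finally show ?thesis by (simp add: sum_distrib_left mult_ac)
  qed
  then have "connected_sum u v =
     (\<Sum>q. \<Sum>p. ennreal (word_sum u p) * ennreal (if p < q then word_sum v q * connector p q else 0))"
    unfolding connected_sum_def by simp
  also have "\<dots> = (\<Sum>p. \<Sum>q. ennreal (word_sum u p) * ennreal (if p < q then word_sum v q * connector p q else 0))"
    by (rule suminf_swap_ennreal)
  finally show ?thesis by (simp add: tail_sum_def ennreal_suminf_cmult)
qed

text \<open>Expand the letter 1 into a sum over \<open>j < q\<close> and sum over \<open>q\<close>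
  first, which gives \<open>connector p (max p j) / p\<close>. The indices \<open>j > p\<close>
  reproduce the tail sum of \<open>v\<close>; \<open>j = p\<close> and \<open>j < p\<close> give the
  two parts of the diagonal term.\<close>

lemma tail_sum_True:
  assumes "0 < p"
  shows "tail_sum (True # v) p = ennreal (1 / real p) * tail_sum v p
     + ennreal (connector p p * (word_sum v p / real p + word_sum (True # v) p))"
proof -
  \<comment> \<open>The conditions \<open>p < q\<close> and \<open>j < q\<close> are merged into one
    lower bound on \<open>q\<close>.\<close>
  have "ennreal (if p < q then word_sum (True # v) q * connector p q else 0) =
     (\<Sum>j. ennreal (word_sum v j) * ennreal (if max p j < q then connector p q / real q else 0))" for q
  proof -
    have "(\<Sum>j. ennreal (word_sum v j) * ennreal (if max p j < q then connector p q / real q else 0))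
       = (\<Sum>j<q. ennreal (word_sum v j) * ennreal (if max p j < q then connector p q / real q else 0))"
      by (intro suminf_finite) auto
    also have "\<dots> = (\<Sum>j<q. ennreal (word_sum v j * (if p < q then connector p q / real q else 0)))"
      by (intro sum.cong) (auto simp: ennreal_mult)
    also have "\<dots> = ennreal (\<Sum>j<q. word_sum v j * (if p < q then connector p q / real q else 0))"
      by (intro sum_ennreal) auto
    also have "(\<Sum>j<q. word_sum v j * (if p < q then connector p q / real q else 0))
       = (if p < q then word_sum (True # v) q * connector p q else 0)"
      by (simp add: sum_distrib_right sum_divide_distrib)
    finally show ?thesis ..
  qed
  then have "tail_sum (True # v) p =
     (\<Sum>q. \<Sum>j. ennreal (word_sum v j) * ennreal (if max p j < q then connector p q / real q else 0))"
    unfolding tail_sum_def by simp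
  also have "\<dots> = (\<Sum>j. \<Sum>q. ennreal (word_sum v j) * ennreal (if max p j < q then connector p q / real q else 0))"
    by (rule suminf_swap_ennreal)
  also have "\<dots> = (\<Sum>j. ennreal (word_sum v j) * (\<Sum>q. ennreal (if max p j < q then connector p q / real q else 0)))"
    by (simp only: ennreal_suminf_cmult)
  also have "\<dots> = (\<Sum>j. ennreal (word_sum v j) * ennreal (connector p (max p j) / real p))"
    by (intro suminf_cong arg_cong2[where f = times] refl
        suminf_ennreal_eq[OF _ connector_tail_sums[OF assms]]) simp
  also have "\<dots> = (\<Sum>j. ennreal (1 / real p) * ennreal (if p < j then word_sum v j * connector p j else 0)
       + ennreal (if j \<le> p then connector p p / real p * word_sum v j else 0))"
    by (intro suminf_cong) (auto simp: max_def mult_ac simp flip: ennreal_mult)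
  also have "\<dots> = ennreal (1 / real p) * tail_sum v p
      + (\<Sum>j. ennreal (if j \<le> p then connector p p / real p * word_sum v j else 0))"
    by (simp only: suminf_add[OF summableI summableI, symmetric] ennreal_suminf_cmult tail_sum_def)
  also have "(\<Sum>j. ennreal (if j \<le> p then connector p p / real p * word_sum v j else 0))
     = (\<Sum>j<Suc p. ennreal (if j \<le> p then connector p p / real p * word_sum v j else 0))"
    by (intro suminf_finite) auto
  also have "\<dots> = (\<Sum>j<Suc p. ennreal (connector p p / real p * word_sum v j))"
    by (intro sum.cong) auto
  also have "\<dots> = ennreal (\<Sum>j<Suc p. connector p p / real p * word_sum v j)"
    by (intro sum_ennreal) auto
  also have "(\<Sum>j<Suc p. connector p p / real p * word_sum v j) = connector p p * (word_sum v p / real p + word_sum (True # v) p)"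
    unfolding sum_distrib_left[symmetric] by (simp add: distrib_left add_divide_distrib add.commute)
  finally show ?thesis .
qed

lemma connected_sum_True:
  assumes "u \<noteq> []"
  shows "connected_sum u (True # v) =
     connected_sum (False # u) v + (\<Sum>m. ennreal (diagonal_term (False # u) v m + diagonal_term u (True # v) m))"
proof -
  have "ennreal (word_sum u p) * tail_sum (True # v) p = ennreal (word_sum (False # u) p) * tail_sum v p
      + ennreal (diagonal_term (False # u) v p + diagonal_term u (True # v) p)" for p
  proof (cases "p = 0")
    case True
    \<comment> \<open>At \<open>p = 0\<close> the tail sum has no usable recursion; a nonempty
      \<open>u\<close> has value 0 there.\<close>
    then show ?thesis using assms by (simp add: word_sum_0 diagonal_term_def)
  next
    case False
    have "ennreal (word_sum u p) * tail_sum (True # v) p =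
       ennreal (word_sum u p) * ennreal (1 / real p) * tail_sum v p
     + ennreal (word_sum u p) * ennreal (connector p p * (word_sum v p / real p + word_sum (True # v) p))"
      using False by (subst tail_sum_True) (auto simp: distrib_left mult.assoc simp del: word_sum.simps)
    also have "ennreal (word_sum u p) * ennreal (1 / real p) = ennreal (word_sum (False # u) p)"
      by (simp flip: ennreal_mult)
    also have "ennreal (word_sum u p) * ennreal (connector p p * (word_sum v p / real p + word_sum (True # v) p))
       = ennreal (word_sum u p * (connector p p * (word_sum v p / real p + word_sum (True # v) p)))"
      by (intro ennreal_mult[symmetric]) (auto intro!: mult_nonneg_nonneg add_nonneg_nonneg simp del: word_sum.simps)
    also have "word_sum u p * (connector p p * (word_sum v p / real p + word_sum (True # v) p))
       = diagonal_term (False # u) v p + diagonal_term u (True # v) p"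
      by (simp add: diagonal_term_def algebra_simps del: word_sum.simps(3))
    finally show ?thesis .
  qed
  then show ?thesis
    unfolding connected_sum_eq_tail_sum by (simp only: suminf_add[OF summableI summableI])
qed

section \<open>Telescoping over all cuts and collecting the weights\<close>

lemma connected_sum_expansion:
  assumes "w \<noteq> []" "\<not> hd w" "last w"
  defines "d \<equiv> \<lambda>i. diagonal_term (rev (map Not (take i w))) (drop i w)"
  shows "(\<Sum>m. ennreal (word_sum w m)) =
    (\<Sum>m. ennreal (\<Sum>i<length w. if w ! i then d (Suc i) m + d i m else 2 * d (Suc i) m))"
proof -
  define T where "T i = connected_sum (rev (map Not (take i w))) (drop i w)" for i
  define e where "e i m = (if w ! i then d (Suc i) m + d i m else 2 * d (Suc i) m)" for i m
  have e_nonneg: "0 \<le> e i m" for i m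
    by (simp add: e_def d_def)
  have T_step: "T i = T (Suc i) + (\<Sum>m. ennreal (e i m))" if "i < length w" for i
  proof -
    let ?u = "rev (map Not (take i w))"
    have drop: "drop i w = w ! i # drop (Suc i) w"
      using that by (simp add: Cons_nth_drop_Suc)
    have u: "rev (map Not (take (Suc i) w)) = (\<not> w ! i) # ?u"
      using that by (simp add: take_Suc_conv_app_nth)
    show ?thesis
    proof (cases "w ! i")
      case True
      \<comment> \<open>The word begins with 0, so a letter 1 never has to be moved to an empty left
        word.\<close>
      then have "i \<noteq> 0" using assms by (metis hd_conv_nth)
      then have "?u \<noteq> []" using assms by simp
      then show ?thesis
        using connected_sum_True[of ?u "drop (Suc i) w"] True
        unfolding T_def e_def d_def u by (simp add: drop)
    next
      case False
      then show ?thesis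
        using connected_sum_False[of ?u "drop (Suc i) w"]
        unfolding T_def e_def d_def u by (simp add: drop)
    qed
  qed
  have T_0: "T 0 = T n + (\<Sum>m. ennreal (\<Sum>i<n. e i m))" if "n \<le> length w" for n
    using that
  proof (induction n)
    case (Suc n)
    have "(\<Sum>m. ennreal (\<Sum>i<Suc n. e i m)) = (\<Sum>m. ennreal (\<Sum>i<n. e i m) + ennreal (e n m))"
      using e_nonneg by (simp add: ennreal_plus sum_nonneg)
    also have "\<dots> = (\<Sum>m. ennreal (\<Sum>i<n. e i m)) + (\<Sum>m. ennreal (e n m))"
      by (simp only: suminf_add[OF summableI summableI])
    finally show ?case using Suc T_step[of n] by (simp add: ac_simps)
  qed simp
  have "T (length w) = 0"
  proof -
    \<comment> \<open>The empty right word forces \<open>q = 0\<close>, where no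
      \<open>p < q\<close> is left.\<close>
    have "word_sum [] q * (\<Sum>p<q. word_sum u p * connector p q) = 0" for q u
      by (cases q) auto
    then show ?thesis unfolding T_def connected_sum_def
      by (simp only: drop_all order_refl) simp
  qed
  moreover have "T 0 = (\<Sum>m. ennreal (word_sum w m))"
  proof -
    \<comment> \<open>The empty left word forces \<open>p = 0\<close>, where the connector is 1; at
      \<open>q = 0\<close> both sides vanish.\<close>
    have "word_sum w q * (\<Sum>p<q. word_sum [] p * connector p q) = word_sum w q" for q
    proof (cases "q = 0")
      case False
      then have "(\<Sum>p<q. word_sum [] p * connector p q) = (\<Sum>p\<in>{0}. word_sum [] p * connector p q)"
        by (intro sum.mono_neutral_right) auto
      then show ?thesis by simp
    qed (use assms in \<open>simp add: word_sum_0\<close>)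
    then show ?thesis
      unfolding T_def connected_sum_def by (simp only: take_0 drop_0 list.map rev.simps)
  qed
  ultimately show ?thesis using T_0[OF order_refl] by (simp add: e_def)
qed

lemma summable_diagonal_term: "summable (diagonal_term u v)"
proof (rule summable_comparison_test')
  show "summable (\<lambda>m. (1/2 :: real) ^ m)" by (rule summable_geometric) simp
  show "norm (diagonal_term u v m) \<le> (1/2) ^ m" if "m \<ge> 0" for m
  proof -
    have "connector m m * word_sum u m * word_sum v m \<le> (1/2) ^ m * 1 * 1"
      by (intro mult_mono connector_diag_le word_sum_le_1) auto
    then show ?thesis by (simp add: diagonal_term_def)
  qed
qed

text \<open>The diagonal term at cut \<open>i\<close> is met twice: moving letter \<open>i\<close>
  yields it with weight 1 or 2, as the letter is 1 or 0, and moving letter \<open>i + 1\<close>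
  yields it once more exactly if that letter is 1. The total weight is \<open>lam\<close>.\<close>

lemma word_sum_sums_diagonal:
  assumes "w \<noteq> []" "\<not> hd w" "last w"
  defines "d \<equiv> \<lambda>i. diagonal_term (rev (map Not (take i w))) (drop i w)"
  shows "summable (word_sum w)"
    and "(\<lambda>m. \<Sum>i = 1..length w - 1. lam (w ! (i - 1)) (w ! i) * d i m) sums suminf (word_sum w)"
proof -
  define e where "e i m = (if w ! i then d (Suc i) m + d i m else 2 * d (Suc i) m)" for i m
  have e_nonneg: "0 \<le> e i m" for i m
    by (simp add: e_def d_def)
  have "summable (d i)" for i
    unfolding d_def by (rule summable_diagonal_term)
  then have "summable (e i)" for i
    unfolding e_def by (cases "w ! i") (auto intro: summable_add summable_mult)
  then have summ: "summable (\<lambda>m. \<Sum>i<length w. e i m)"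
    by (intro summable_sum) auto
  have eq: "(\<Sum>m. ennreal (word_sum w m)) = (\<Sum>m. ennreal (\<Sum>i<length w. e i m))"
    unfolding e_def d_def by (rule connected_sum_expansion[OF assms(1-3)])
  also have "\<dots> = ennreal (\<Sum>m. \<Sum>i<length w. e i m)"
    using e_nonneg summ by (intro suminf_ennreal2 sum_nonneg) auto
  finally have *: "(\<Sum>m. ennreal (word_sum w m)) = ennreal (\<Sum>m. \<Sum>i<length w. e i m)" .
  \<comment> \<open>The diagonal side is finite, and this is what proves convergence.\<close>
  then show sw: "summable (word_sum w)"
    by (intro summable_suminf_not_top) auto
  have "ennreal (suminf (word_sum w)) = ennreal (\<Sum>m. \<Sum>i<length w. e i m)"
    using * sw by (simp add: suminf_ennreal2)
  then have "suminf (word_sum w) = (\<Sum>m. \<Sum>i<length w. e i m)"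
    using e_nonneg sw summ by (subst (asm) ennreal_inj) (auto intro!: suminf_nonneg sum_nonneg)
  then have sums: "(\<lambda>m. \<Sum>i<length w. e i m) sums suminf (word_sum w)"
    using summ by (simp add: sums_iff)
  obtain k where k: "length w = Suc k"
    using assms(1) by (cases w) auto
  have "(\<Sum>i<length w. e i m) = (\<Sum>i = 1..length w - 1. lam (w ! (i - 1)) (w ! i) * d i m)" for m
  proof -
    \<comment> \<open>At the two extreme cuts one word is empty and supported at 0, where the other
      word vanishes.\<close>
    have d0: "d 0 m = 0"
      using assms(1) by (cases "m = 0") (auto simp: d_def diagonal_term_def word_sum_0)
    have dk: "d (Suc k) m = 0"
      using assms(1) k by (cases "m = 0") (auto simp: d_def diagonal_term_def word_sum_0)
    let ?l = "\<lambda>i. (if w ! i then 1 else 2) * d (Suc i) m" and ?r = "\<lambda>i. (if w ! i then 1 else 0) * d i m"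
    have "(\<Sum>i<length w. e i m) = (\<Sum>i<Suc k. ?l i) + (\<Sum>i<Suc k. ?r i)"
      unfolding k sum.distrib[symmetric] by (intro sum.cong) (auto simp: e_def)
    also have "(\<Sum>i<Suc k. ?l i) = (\<Sum>i<k. ?l i)"
      using dk by simp
    also have "(\<Sum>i<Suc k. ?r i) = (\<Sum>i<k. ?r (Suc i))"
      using d0 by (subst sum.lessThan_Suc_shift) simp
    also have "(\<Sum>i<k. ?l i) + (\<Sum>i<k. ?r (Suc i)) = (\<Sum>i<k. lam (w ! i) (w ! Suc i) * d (Suc i) m)"
      unfolding sum.distrib[symmetric]
    proof (intro sum.cong refl)
      show "?l i + ?r (Suc i) = lam (w ! i) (w ! Suc i) * d (Suc i) m" for i
        by (cases "w ! i"; cases "w ! Suc i") simp_all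
    qed
    also have "\<dots> = (\<Sum>i = 1..length w - 1. lam (w ! (i - 1)) (w ! i) * d i m)"
      by (rule sum.reindex_bij_witness[of _ "\<lambda>i. i - 1" Suc]) (auto simp: k)
    finally show ?thesis .
  qed
  then show "(\<lambda>m. \<Sum>i = 1..length w - 1. lam (w ! (i - 1)) (w ! i) * d i m) sums suminf (word_sum w)"
    using sums by simp
qed

section \<open>Identification with zeta values and with \<open>phi\<close>\<close>

text \<open>The possible tails of a decreasing tuple with first entry \<open>m > 0\<close>.
  Splitting off the largest index corresponds to reading one block \<open>0...01\<close> of the
  word.\<close>

definition bounded_tuples :: "nat \<Rightarrow> nat \<Rightarrow> nat list set" where
  "bounded_tuples r m = {ns \<in> decreasing_tuples r. \<forall>n\<in>set ns. n < m}"

lemma finite_bounded_tuples [simp]: "finite (bounded_tuples r m)"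
  unfolding bounded_tuples_def by (rule finite_bounded_decreasing_tuples)

lemma bij_betw_Cons_decreasing_tuples:
  "bij_betw (\<lambda>(n, ns). n # ns) (Sigma {0<..} (bounded_tuples r)) (decreasing_tuples (Suc r))"
  by (rule bij_betwI[of _ _ _ "\<lambda>ns. (hd ns, tl ns)"])
     (auto simp: bounded_tuples_def decreasing_tuples_def length_Suc_conv)

lemma bij_betw_Cons_bounded_tuples:
  "bij_betw (\<lambda>(n, ns). n # ns) (Sigma {0<..<m} (bounded_tuples r)) (bounded_tuples (Suc r) m)"
  by (rule bij_betwI[of _ _ _ "\<lambda>ns. (hd ns, tl ns)"])
     (auto simp: bounded_tuples_def decreasing_tuples_def length_Suc_conv, meson less_trans)

lemma mzv_term_Cons [simp]: "mzv_term (x # c) (n # ns) = 1 / real n ^ x * mzv_term c ns"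
  unfolding mzv_term_def by (simp add: prod.lessThan_Suc_shift del: prod.lessThan_Suc)

lemma mzv_term_nonneg: "0 \<le> mzv_term c ns"
  unfolding mzv_term_def by (intro prod_nonneg) auto

lemma word_sum_replicate_False: "word_sum (replicate k False @ v) n = word_sum v n / real n ^ k"
  by (induction k) auto

lemma word_sum_binary_word_Cons:
  assumes "1 \<le> x"
  shows "word_sum (binary_word (x # c)) n = 1 / real n ^ x * (\<Sum>j<n. word_sum (binary_word c) j)"
  using assms by (cases x) (auto simp: word_sum_replicate_False)

text \<open>Positivity of \<open>m\<close> matters for \<open>c = []\<close>: the empty tuple
  contributes 1, matched by the value of the empty word at \<open>j = 0\<close>.\<close>

lemma sum_word_sum_binary_word:
  assumes "is_composition c" "0 < m"
  shows "(\<Sum>j<m. word_sum (binary_word c) j) = (\<Sum>ns\<in>bounded_tuples (length c) m. mzv_term c ns)"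
  using assms
proof (induction c arbitrary: m)
  case Nil
  have "bounded_tuples 0 m = {[]}"
    by (auto simp: bounded_tuples_def decreasing_tuples_def)
  moreover have "(\<Sum>j<m. word_sum [] j) = (\<Sum>j\<in>{0}. word_sum [] j)"
    using Nil by (intro sum.mono_neutral_right) auto
  ultimately show ?case by (simp add: mzv_term_def)
next
  case (Cons x c)
  then have x: "1 \<le> x" and c: "is_composition c" by (auto simp: is_composition_def)
  have "(\<Sum>ns\<in>bounded_tuples (length (x # c)) m. mzv_term (x # c) ns)
      = (\<Sum>(n, ns)\<in>Sigma {0<..<m} (bounded_tuples (length c)). mzv_term (x # c) (n # ns))"
    using sum.reindex_bij_betw[OF bij_betw_Cons_bounded_tuples[of m "length c"], of "mzv_term (x # c)"]
    by (simp add: case_prod_unfold del: mzv_term_Cons)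
  also have "\<dots> = (\<Sum>n\<in>{0<..<m}. \<Sum>ns\<in>bounded_tuples (length c) n. mzv_term (x # c) (n # ns))"
    by (subst sum.Sigma) auto
  also have "\<dots> = (\<Sum>n\<in>{0<..<m}. word_sum (binary_word (x # c)) n)"
    using Cons.IH[OF c]
    by (intro sum.cong refl) (simp add: word_sum_binary_word_Cons[OF x] sum_distrib_left del: binary_word_Cons)
  also have "\<dots> = (\<Sum>n<m. word_sum (binary_word (x # c)) n)"
    by (intro sum.mono_neutral_left) (auto simp: word_sum_0)
  finally show ?case ..
qed

lemma phi_eq_word_sum:
  assumes "is_composition c" "c \<noteq> []" "0 < m"
  shows "phi m c = word_sum (binary_word c) m"
proof -
  obtain x c' where c: "c = x # c'" using assms by (cases c) auto
  then have "1 \<le> x" "is_composition c'" using assms by (auto simp: is_composition_def)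
  then show ?thesis
    using assms(3) unfolding phi_def c bounded_tuples_def[symmetric]
    by (simp add: word_sum_binary_word_Cons sum_word_sum_binary_word del: binary_word_Cons)
qed

text \<open>Group the tuples by their largest entry \<open>n\<close>; each group is finite with sum
  \<open>word_sum (binary_word c) n\<close>. Since all terms are nonnegative, convergence of the
  series gives unconditional summability.\<close>

lemma mzv_eq_suminf_word_sum:
  assumes "is_composition c" "c \<noteq> []" "summable (word_sum (binary_word c))"
  shows "mzv c = suminf (word_sum (binary_word c))"
proof -
  obtain x c' where c: "c = x # c'" using assms by (cases c) auto
  then have x: "1 \<le> x" and c': "is_composition c'" using assms by (auto simp: is_composition_def)
  let ?W = "word_sum (binary_word c)" and ?f = "\<lambda>(n, ns). mzv_term c (n # ns)"
  have fib: "((\<lambda>ns. ?f (n, ns)) has_sum ?W n) (bounded_tuples (length c') n)" if "n \<in> {0<..}" for n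
  proof -
    have "?W n = (\<Sum>ns\<in>bounded_tuples (length c') n. ?f (n, ns))"
      using that c' x unfolding c by (simp add: word_sum_binary_word_Cons sum_word_sum_binary_word
          sum_distrib_left del: binary_word_Cons)
    then show ?thesis by (simp add: has_sum_finite)
  qed
  have "(?W has_sum suminf ?W) UNIV"
    using assms(3) by (intro sums_nonneg_imp_has_sum summable_sums) auto
  moreover have "?W 0 = 0" by (simp add: word_sum_0 c)
  ultimately have W: "(?W has_sum suminf ?W) {0<..}"
    by (subst has_sum_cong_neutral[of UNIV _ ?W ?W]) (auto simp: not_less)
  have "(?f has_sum suminf ?W) (Sigma {0<..} (bounded_tuples (length c')))"
  proof (rule has_sum_SigmaI[OF fib W])
    show "?f summable_on Sigma {0<..} (bounded_tuples (length c'))"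
      using W by (intro summable_on_SigmaI[OF fib]) (auto simp: mzv_term_nonneg summable_on_def)
  qed
  then have "((\<lambda>p. mzv_term c ((\<lambda>(n, ns). n # ns) p)) has_sum suminf ?W) (Sigma {0<..} (bounded_tuples (length c')))"
    by (simp add: case_prod_unfold)
  then have "(mzv_term c has_sum suminf ?W) (decreasing_tuples (Suc (length c')))"
    by (subst (asm) has_sum_reindex_bij_betw[OF bij_betw_Cons_decreasing_tuples])
  then show ?thesis unfolding mzv_def c by (simp add: infsumI)
qed

lemma phi_composition_of_word:
  assumes "v \<noteq> []" "last v" "0 < m"
  shows "phi m (composition_of_word v) = word_sum v m"
proof -
  have "is_composition (composition_of_word v)" "binary_word (composition_of_word v) = v"
    using composition_of_word[of v] assms by auto
  moreover from this have "composition_of_word v \<noteq> []" using assms by auto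
  ultimately show ?thesis using phi_eq_word_sum assms by simp
qed

section \<open>The central binomial expansion of zeta values\<close>

theorem theorem6:
  fixes a :: "nat list"
  assumes "admissible a" and "a \<noteq> []"
  shows "(\<lambda>m. psi (Suc m) a / real (2 * Suc m choose Suc m)) sums mzv a"
proof -
  define w where "w = binary_word a"
  let ?d = "\<lambda>i. diagonal_term (rev (map Not (take i w))) (drop i w)"
  have comp: "is_composition a" using assms by (simp add: admissible_def)
  obtain x c where a: "a = x # c" using assms(2) by (cases a) auto
  have "2 \<le> x" using assms by (simp add: admissible_def a)
  then obtain y where "x = Suc (Suc y)" by (metis add_2_eq_Suc le_Suc_ex)
  then have w: "w \<noteq> []" "\<not> hd w" by (auto simp: w_def a)
  have last: "last w" using binary_word_ends[of a] assms by (simp add: w_def)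
  note main = word_sum_sums_diagonal[OF w last]
  have mzv: "mzv a = suminf (word_sum w)"
    using mzv_eq_suminf_word_sum[OF comp assms(2)] main(1) by (simp add: w_def)
  have "psi m a / real (2 * m choose m) = (\<Sum>i = 1..length w - 1. lam (w ! (i - 1)) (w ! i) * ?d i m)"
    if "0 < m" for m
    unfolding psi_def w_def[symmetric] sum_divide_distrib
  proof (intro sum.cong refl)
    fix i assume i: "i \<in> {1..length w - 1}"
    have "phi m (suffix_composition a i) = word_sum (drop i w) m"
      unfolding suffix_composition_def w_def[symmetric]
      using i last that by (intro phi_composition_of_word) auto
    \<comment> \<open>The reversed complement ends with the complement of the first letter 0, so it
      is the word of a composition.\<close>
    moreover have "phi m (dual_prefix_composition a i) = word_sum (rev (map Not (take i w))) m"
      unfolding dual_prefix_composition_def w_def[symmetric]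
      using i w that by (intro phi_composition_of_word) (auto simp: last_rev hd_map)
    ultimately show "lam (w ! (i - 1)) (w ! i) * phi m (suffix_composition a i) *
        phi m (dual_prefix_composition a i) / real (2 * m choose m) = lam (w ! (i - 1)) (w ! i) * ?d i m"
      by (simp add: diagonal_term_def connector_diag)
  qed
  \<comment> \<open>The series in \<open>main\<close> starts at \<open>m = 0\<close>; its zeroth
    term vanishes, which permits the shift to \<open>Suc m\<close>.\<close>
  moreover have "(\<Sum>i = 1..length w - 1. lam (w ! (i - 1)) (w ! i) * ?d i 0) = 0"
    by (intro sum.neutral) (auto simp: diagonal_term_def word_sum_0)
  ultimately show ?thesis
    using main(2) sums_Suc_iff[of "\<lambda>m. \<Sum>i = 1..length w - 1. lam (w ! (i - 1)) (w ! i) * ?d i m"]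
    unfolding mzv by (simp only: zero_less_Suc add_0_right)
qed

end
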